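(* Let $S_{10}=(s_0,s_1,\dots,s_{47})$ be the sequence $$\begin{aligned}\bigl(&4^2,(-8)^2,(-4)^2,6^4,8^2,(-6)^4,4^2,(-8)^2,(-4)^2,8^2,4^2,8^2,\\&(-4)^2,(-8)^2,4^2,(-8)^2,(-4)^2,8^2,4^2,8^2,(-4)^2,(-8)^2\bigr),\end{aligned}$$ where $u^k$ stands for $k$ consecutive entries equal to $u$. Let $\varphi_{10}:\mathbb{N}\to\mathbb{N}$ be the function defined as follows. The values $\varphi_{10}(0),\varphi_{10}(1),\dots,\varphi_{10}(65)$ are, in order (ten per row), $$\begin{array}{l}12,13,10,11,8,9,16,17,4,5,\\ 2,3,0,1,24,25,6,7,22,23,\\ 26,27,18,19,14,15,20,21,32,33,\\ 36,37,28,29,38,39,30,31,34,35,\\ 48,49,46,47,50,51,42,43,40,41,\\ 44,45,56,57,62,63,52,53,64,65,\\ 68,69,54,55,58,59,\end{array}$$ and for $x\ge 66$, $$\varphi_{10}(x)=x+s_{x-66},$$ where the index $x-66$ is taken modulo $48$. Then, for all nonnegative integers $a,b$, the Halve Nim position $a^1b^1{10}^1$ is a $\mathcal{P}$-position if and only if $b=\varphi_{10}(a)$.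
   Context: $\mathbb{N}$ is the set of nonnegative integers. Halve Nim is a two-player game played on finitely many piles of coins; players alternate moves and a player who cannot move loses. A move is one of: (i) choose one pile and remove at least one coin from it; (ii) halve the game: simultaneously replace every pile of $m$ coins by a pile of $\lfloor m/2\rfloor$ coins. When there are no coins left, no move is available (halving requires at least one coin to be present). A position is a $\mathcal{P}$-position if the player who is not about to move has a winning strategy (equivalently, every move from it leads to an $\mathcal{N}$-position), and an $\mathcal{N}$-position if the player about to move has a winning strategy. $a^1b^1c^1$ denotes the position with three piles of sizes $a$, $b$, $c$ (a pile of size $0$ is an empty pile); in particular $a^1b^1{10}^1$ has piles of sizes $a$, $b$, $10$. *)

theory Defs
  imports Main "HOL-Library.Multiset"
begin

text \<open>A position is the multiset of its pile sizes; piles of size 0 are permitted and are inert.\<close>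

type_synonym position = "nat multiset"

inductive halve_nim_move :: "position \<Rightarrow> position \<Rightarrow> bool" where
  remove: "k < m \<Longrightarrow> halve_nim_move (add_mset m p) (add_mset k p)"
| halve: "sum_mset p > 0 \<Longrightarrow> halve_nim_move p (image_mset (\<lambda>m. m div 2) p)"

text \<open>
  The outcome classes are least fixed points: a derivation of \<open>P_position p\<close> (resp.
  \<open>N_position p\<close>) is a winning strategy, ending after finitely many moves, for the player
  who is not about to move (resp. who is about to move).
\<close>

inductive P_position :: "position \<Rightarrow> bool" and N_position :: "position \<Rightarrow> bool" where
  P: "(\<And>q. halve_nim_move p q \<Longrightarrow> N_position q) \<Longrightarrow> P_position p"
| N: "halve_nim_move p q \<Longrightarrow> P_position q \<Longrightarrow> N_position p"

definition S10 :: "int list" where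
  "S10 = concat
    [replicate 2 4, replicate 2 (-8), replicate 2 (-4), replicate 4 6, replicate 2 8,
     replicate 4 (-6), replicate 2 4, replicate 2 (-8), replicate 2 (-4), replicate 2 8,
     replicate 2 4, replicate 2 8,
     replicate 2 (-4), replicate 2 (-8), replicate 2 4, replicate 2 (-8), replicate 2 (-4),
     replicate 2 8, replicate 2 4, replicate 2 8, replicate 2 (-4), replicate 2 (-8)]"

definition phi10_init :: "nat list" where
  "phi10_init =
    [12, 13, 10, 11, 8, 9, 16, 17, 4, 5,
     2, 3, 0, 1, 24, 25, 6, 7, 22, 23,
     26, 27, 18, 19, 14, 15, 20, 21, 32, 33,
     36, 37, 28, 29, 38, 39, 30, 31, 34, 35,
     48, 49, 46, 47, 50, 51, 42, 43, 40, 41,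
     44, 45, 56, 57, 62, 63, 52, 53, 64, 65,
     68, 69, 54, 55, 58, 59]"

definition phi10 :: "nat \<Rightarrow> nat" where
  "phi10 x = (if x < 66 then phi10_init ! x else nat (int x + S10 ! ((x - 66) mod 48)))"

lemma length_S10: "length S10 = 48"
  by (simp add: S10_def)

lemma length_phi10_init: "length phi10_init = 66"
  by (simp add: phi10_init_def)

text \<open>The conversion to \<^typ>\<open>nat\<close> in \<^const>\<open>phi10\<close> never truncates.\<close>

lemma int_phi10:
  assumes "x \<ge> 66"
  shows "int (phi10 x) = int x + S10 ! ((x - 66) mod 48)"
proof -
  have "\<forall>s\<in>set S10. s \<ge> -8"
    by (simp add: S10_def)
  moreover have "S10 ! ((x - 66) mod 48) \<in> set S10"
    by (simp add: length_S10)
  ultimately have "S10 ! ((x - 66) mod 48) \<ge> -8"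
    by blast
  with assms show ?thesis
    by (simp add: phi10_def)
qed

end

theory Submission
  imports Defs "HOL-Library.Code_Binary_Nat"
begin

text \<open>
  For every fixed \<open>c\<close> the P-positions \<open>{#a, b, c#}\<close> form the graph of an involution \<open>b = \<phi>\<^sub>c(a)\<close>, and
  moves from \<open>c = 10\<close> only lead to \<open>c \<le> 10\<close>, so the eleven functions \<open>\<phi>\<^sub>0, \<dots>, \<phi>\<^sub>1\<^sub>0\<close> are
  determined simultaneously by induction on the number of coins. For \<open>c \<ge> 4\<close> the difference
  \<open>\<phi>\<^sub>c(x) - x\<close> is eventually periodic. For \<open>c < 4\<close> it is not: from \<open>x = 32\<close> on, \<open>\<phi>\<^sub>c(x)\<close> is
  \<open>x XOR c\<close> or \<open>x XOR c XOR 2\<close>, and the choice (the phase) alternates between consecutive intervals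
  \<open>28 \<cdot> 2\<^sup>k \<le> x < 28 \<cdot> 2\<^sup>k\<^sup>+\<^sup>1\<close>. In both phases, however, \<open>\<phi>\<^sub>0, \<dots>, \<phi>\<^sub>3\<close> permute each block
  \<open>{4k, \<dots>, 4k+3}\<close>, and \<open>x\<close> and \<open>x div 2\<close> always lie in opposite phases when \<open>x \<ge> 56\<close>. Hence the
  conditions characterising the P-positions involve only bounded differences and one bit of phase, and
  they reduce modulo 48 to a finite computation.
\<close>

subsection \<open>Outcomes of three-pile positions\<close>

lemma halve_nim_move_less:
  assumes "halve_nim_move p q"
  shows "sum_mset q < sum_mset p"
  using assms
proof cases
  case halve
  have "2 * sum_mset (image_mset (\<lambda>m. m div 2) r) \<le> sum_mset r" for r :: position
    by (induction r) auto
  from this[of p] halve show ?thesis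
    by simp
qed auto

text \<open>Every move lowers the number of coins, so induction on it makes the two least fixed
  points complementary.\<close>

lemma N_position_iff: "N_position p \<longleftrightarrow> \<not> P_position p"
proof (induction "sum_mset p" arbitrary: p rule: less_induct)
  case less
  have "N_position q \<longleftrightarrow> \<not> P_position q" if "halve_nim_move p q" for q
    using less halve_nim_move_less[OF that] by blast
  then show ?case
    by (subst N_position.simps, subst P_position.simps) blast
qed

lemma P_position_iff: "P_position p \<longleftrightarrow> (\<forall>q. halve_nim_move p q \<longrightarrow> \<not> P_position q)"
  by (subst P_position.simps) (simp add: N_position_iff)

lemma halve_nim_move_remove:
  assumes "m \<in># p" "k < m"
  shows "halve_nim_move p (add_mset k (p - {#m#}))"
  using assms halve_nim_move.remove[of k m "p - {#m#}"] by simp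

lemma halve_nim_move_iff:
  "halve_nim_move p q \<longleftrightarrow>
    (\<exists>m k. m \<in># p \<and> k < m \<and> q = add_mset k (p - {#m#})) \<or>
    sum_mset p > 0 \<and> q = image_mset (\<lambda>m. m div 2) p"
  (is "?move \<longleftrightarrow> ?remove \<or> ?halve")
proof
  assume ?move
  then show "?remove \<or> ?halve"
  proof cases
    case (remove k m r)
    then have "m \<in># p \<and> k < m \<and> q = add_mset k (p - {#m#})"
      by simp
    then show ?thesis by blast
  qed simp
next
  assume "?remove \<or> ?halve"
  then show ?move
    by (auto intro: halve_nim_move_remove halve_nim_move.halve)
qed

lemma halve_nim_move_three_iff:
  "halve_nim_move {#a, b, c#} q \<longleftrightarrow>
    (\<exists>k<a. q = {#k, b, c#}) \<or> (\<exists>k<b. q = {#a, k, c#}) \<or> (\<exists>k<c. q = {#a, b, k#}) \<or>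
    0 < a + b + c \<and> q = {#a div 2, b div 2, c div 2#}"
proof -
  have "{#a, b, c#} - {#a#} = {#b, c#}" "{#a, b, c#} - {#b#} = {#a, c#}"
    "{#a, b, c#} - {#c#} = {#a, b#}"
    by (auto simp: multiset_eq_iff)
  then have "(\<exists>m k. m \<in># {#a, b, c#} \<and> k < m \<and> q = add_mset k ({#a, b, c#} - {#m#})) \<longleftrightarrow>
    (\<exists>k<a. q = {#k, b, c#}) \<or> (\<exists>k<b. q = {#k, a, c#}) \<or> (\<exists>k<c. q = {#k, a, b#})"
    by (auto simp del: diff_add_mset_swap add_mset_remove_trivial)
  then show ?thesis
    by (subst halve_nim_move_iff) (simp add: add_mset_commute)
qed

lemma P_position_three_iff:
  "P_position {#a, b, c#} \<longleftrightarrow>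
    (\<forall>k<a. \<not> P_position {#k, b, c#}) \<and> (\<forall>k<b. \<not> P_position {#a, k, c#}) \<and>
    (\<forall>k<c. \<not> P_position {#a, b, k#}) \<and>
    (0 < a + b + c \<longrightarrow> \<not> P_position {#a div 2, b div 2, c div 2#})"
  by (subst P_position_iff) (auto simp: halve_nim_move_three_iff)

subsection \<open>The involutions\<close>

definition diff_extend :: "nat list \<Rightarrow> int list \<Rightarrow> nat \<Rightarrow> nat" where
  "diff_extend xs ds x =
    (if x < length xs then xs ! x
     else nat (int x + ds ! ((x - length xs) mod length ds)))"

definition init_row :: "nat \<Rightarrow> nat list" where
  "init_row c =
    (if c = 0 then
     [0, 2, 1, 3, 4, 5, 8, 9, 6, 7, 12, 13, 10, 11, 14, 15, 16, 17, 18, 19, 20, 21, 22,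
      23, 24, 25, 26, 27, 30, 31, 28, 29]
     else if c = 1 then
     [2, 3, 0, 1, 5, 4, 9, 8, 7, 6, 13, 12, 11, 10, 15, 14, 17, 16, 19, 18, 21, 20, 23,
      22, 25, 24, 27, 26, 31, 30, 29, 28]
     else if c = 2 then
     [1, 0, 2, 4, 3, 6, 5, 7, 8, 9, 10, 11, 12, 13, 18, 19, 20, 21, 14, 15, 16, 17, 26,
      27, 28, 29, 22, 23, 24, 25, 30, 31]
     else if c = 3 then
     [3, 1, 4, 0, 2, 7, 6, 5, 9, 8, 11, 10, 13, 12, 19, 18, 21, 20, 15, 14, 17, 16, 27,
      26, 29, 28, 23, 22, 25, 24, 31, 30]
     else if c = 4 then
     [4, 5, 3, 2, 0, 1, 7, 6, 10, 11, 8, 9, 14, 15, 12, 13, 18, 19, 16, 17, 22, 23, 20,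
      21, 26, 27, 24, 25, 28, 29]
     else if c = 5 then
     [5, 4, 6, 7, 1, 0, 2, 3, 11, 10, 9, 8, 15, 14, 13, 12, 19, 18, 17, 16, 23, 22, 21,
      20, 27, 26, 25, 24, 29, 28]
     else if c = 6 then
     [8, 9, 5, 6, 7, 2, 3, 4, 0, 1, 16, 17, 18, 19, 20, 21, 10, 11, 12, 13, 14, 15, 24,
      25, 22, 23, 28, 29, 26, 27]
     else if c = 7 then
     [9, 8, 7, 5, 6, 3, 4, 2, 1, 0, 17, 16, 19, 18, 21, 20, 11, 10, 13, 12, 15, 14, 25,
      24, 23, 22, 29, 28, 27, 26]
     else if c = 8 then
     [6, 7, 8, 9, 10, 11, 0, 1, 2, 3, 4, 5, 16, 17, 22, 23, 12, 13, 20, 21, 18, 19, 14,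
      15, 30, 31, 32, 33, 34, 35, 24, 25, 26, 27, 28, 29, 40, 41, 44, 45, 36, 37, 48,
      49, 38, 39, 52, 53, 42, 43, 56, 57, 46, 47, 60, 61, 50, 51, 62, 63, 54, 55, 58,
      59]
     else if c = 9 then
     [7, 6, 9, 8, 11, 10, 1, 0, 3, 2, 5, 4, 17, 16, 23, 22, 13, 12, 21, 20, 19, 18, 15,
      14, 31, 30, 33, 32, 35, 34, 25, 24, 27, 26, 29, 28, 41, 40, 45, 44, 37, 36, 49,
      48, 39, 38, 53, 52, 43, 42, 57, 56, 47, 46, 61, 60, 51, 50, 63, 62, 55, 54, 59,
      58]
     else phi10_init)"

text \<open>Rows 0 to 3 list \<open>(x XOR c) - x\<close>, since the initial rows for
  \<open>c < 4\<close> have length 32, a multiple of 4.\<close>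

definition diff_row :: "nat \<Rightarrow> int list" where
  "diff_row c =
    (if c = 0 then [0]
     else if c = 1 then [1, -1]
     else if c = 2 then [2, 2, -2, -2]
     else if c = 3 then [3, 1, -1, -3]
     else if c = 4 then [2, 2, -2, -2]
     else if c = 5 then [3, 1, -1, -3]
     else if c = 6 then [4, 4, 4, 4, -4, -4, -4, -4]
     else if c = 7 then [5, 3, 5, 3, -3, -5, -3, -5]
     else if c = 8 then [6, 6, 6, 6, 6, 6, -6, -6, -6, -6, -6, -6]
     else if c = 9 then [7, 5, 7, 5, 7, 5, -5, -7, -5, -7, -5, -7]
     else S10)"

text \<open>The phase \<open>s = True\<close> replaces \<open>x XOR c\<close> by \<open>x XOR c XOR 2\<close> when \<open>c < 4\<close>.\<close>

definition diff_index :: "bool \<Rightarrow> nat \<Rightarrow> nat" where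
  "diff_index s c = (if s then if c < 2 then c + 2 else if c < 4 then c - 2 else c else c)"

definition phase_phi :: "bool \<Rightarrow> nat \<Rightarrow> nat \<Rightarrow> nat" where
  "phase_phi s c = diff_extend (init_row c) (diff_row (diff_index s c))"

fun phase :: "nat \<Rightarrow> bool" where
  "phase x = (if x < 56 then True else \<not> phase (x div 2))"

declare phase.simps [simp del]

definition phi :: "nat \<Rightarrow> nat \<Rightarrow> nat" where
  "phi c x = phase_phi (phase x) c x"

text \<open>
  Here \<open>s\<close> and \<open>s'\<close> stand for the phases of \<open>a\<close> and \<open>a div 2\<close>. The four conjuncts say that no option of
  a claimed P-position \<open>(a, y, c)\<close> is again one, and that every \<open>(a, b, c)\<close> with \<open>b < y\<close> has an option
  that is one. As the involutions make the latter symmetric in \<open>a\<close> and \<open>b\<close>, it is only required for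
  \<open>a \<le> b\<close>.
\<close>

definition locally_ok :: "bool \<Rightarrow> bool \<Rightarrow> nat \<Rightarrow> nat \<Rightarrow> bool" where
  "locally_ok s' s a c \<longleftrightarrow>
    (let y = phase_phi s c a; h = phase_phi s' (c div 2) (a div 2);
         ys = map (\<lambda>c'. phase_phi s c' a) [0..<c]
     in phase_phi s c y = a \<and> y \<notin> set ys \<and> (a = 0 \<and> c = 0 \<or> y div 2 \<noteq> h) \<and>
        (\<forall>b\<in>set [a..<y]. phase_phi s c b \<le> a \<or> b div 2 = h \<or> b \<in> set ys))"

section \<open>Shift invariance and bounds of the eventually periodic rows\<close>

lemma diff_extend_add:
  assumes "length xs \<le> x" "length ds dvd k" "ds \<noteq> []" "\<forall>d\<in>set ds. - int (length xs) \<le> d"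
  shows "diff_extend xs ds (x + k) = diff_extend xs ds x + k"
proof -
  have "(x + k - length xs) mod length ds = (x - length xs) mod length ds"
    using assms(1,2) by (metis Nat.diff_add_assoc2 add.commute mod_add_self2 dvd_def mod_mult_self2)
  moreover have "ds ! ((x - length xs) mod length ds) \<in> set ds"
    using assms(3) by simp
  then have "- int x \<le> ds ! ((x - length xs) mod length ds)"
    using assms(1,4) by fastforce
  ultimately show ?thesis
    using assms(1) by (simp add: diff_extend_def)
qed

lemma diff_extend_ge:
  assumes "length xs \<le> x" "ds \<noteq> []" "\<forall>d\<in>set ds. - int k \<le> d"
  shows "x \<le> diff_extend xs ds x + k"
proof -
  have "ds ! ((x - length xs) mod length ds) \<in> set ds"
    using assms(2) by simp
  then have "- int k \<le> ds ! ((x - length xs) mod length ds)"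
    using assms(3) by blast
  then show ?thesis
    using assms(1) by (simp add: diff_extend_def)
qed

lemma less_11_cases:
  assumes "c < (11::nat)"
  obtains "c = 0" | "c = 1" | "c = 2" | "c = 3" | "c = 4" | "c = 5"
    | "c = 6" | "c = 7" | "c = 8" | "c = 9" | "c = 10"
proof -
  have "\<forall>c<11::nat. c = 0 \<or> c = 1 \<or> c = 2 \<or> c = 3 \<or> c = 4 \<or> c = 5 \<or>
      c = 6 \<or> c = 7 \<or> c = 8 \<or> c = 9 \<or> c = 10"
    by code_simp
  with assms that show thesis by blast
qed

lemma list_all_uptD:
  assumes "list_all (\<lambda>a. list_all (P a) [0..<m]) [i..<j]" "i \<le> a" "a < j" "c < m"
  shows "P a c"
  using assms by (simp add: list_all_iff)

text \<open>All periods divide 48, and 66 is the length of the longest initial row.\<close>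

lemma phase_phi_add_48:
  assumes "c < 11" "66 \<le> x"
  shows "phase_phi s c (x + 48) = phase_phi s c x + 48"
  using assms(1) unfolding phase_phi_def
  by (rule less_11_cases; cases s; intro diff_extend_add)
     (use assms(2) in \<open>simp_all add: init_row_def diff_row_def diff_index_def phi10_init_def S10_def flip: numeral_2_eq_2\<close>)

lemma phase_phi_ge:
  assumes "c < 11" "66 \<le> x"
  shows "x \<le> phase_phi s c x + 8"
  using assms(1) unfolding phase_phi_def
  by (rule less_11_cases; cases s; intro diff_extend_ge)
     (use assms(2) in \<open>simp_all add: init_row_def diff_row_def diff_index_def phi10_init_def S10_def flip: numeral_2_eq_2\<close>)

text \<open>Serves the halved position: shifting \<open>a\<close> by 48 shifts
  \<open>a div 2\<close> by 24, and \<open>c div 2 < 6\<close> when \<open>c < 11\<close>.\<close>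

lemma phase_phi_add_24:
  assumes "c < 6" "32 \<le> x"
  shows "phase_phi s c (x + 24) = phase_phi s c x + 24"
proof -
  have "c < 11" using assms(1) by simp
  then show ?thesis unfolding phase_phi_def
    by (rule less_11_cases; cases s; intro diff_extend_add)
       (use assms in \<open>simp_all add: init_row_def diff_row_def diff_index_def flip: numeral_2_eq_2\<close>)
qed

lemma phase_phi_add_4:
  assumes "c < 4" "32 \<le> x"
  shows "phase_phi s c (x + 4) = phase_phi s c x + 4"
proof -
  have "c < 11" using assms(1) by simp
  then show ?thesis unfolding phase_phi_def
    by (rule less_11_cases; cases s; intro diff_extend_add)
       (use assms in \<open>simp_all add: init_row_def diff_row_def diff_index_def flip: numeral_2_eq_2\<close>)
qed

lemma phase_phi_phase_irrelevant: "4 \<le> c \<Longrightarrow> phase_phi s c = phase_phi s' c"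
  by (simp add: phase_phi_def diff_index_def)

lemma phase_phi_less_32:
  assumes "c < 4" "x < 32"
  shows "phase_phi s c x < 32"
proof -
  have "c < 11" using assms(1) by simp
  then have "\<forall>y\<in>set (init_row c). y < 32" "length (init_row c) = 32"
    by (rule less_11_cases; use assms in \<open>simp add: init_row_def\<close>)+
  with assms(2) show ?thesis
    by (simp add: phase_phi_def diff_extend_def)
qed

text \<open>XOR with a number below 4 changes only the last two bits. One block is computed and the
  rest follow by the period 4.\<close>

lemma phase_phi_div_4:
  assumes "c < 4" "32 \<le> x"
  shows "phase_phi s c x div 4 = x div 4"
  using assms(2)
proof (induction x rule: less_induct)
  case (less x)
  show ?case
  proof (cases "x < 36")
    case True
    have "list_all (\<lambda>x. list_all (\<lambda>c. phase_phi s c x div 4 = x div 4) [0..<4]) [32..<36]"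
      by (cases s; simp only:; code_simp)
    from list_all_uptD[OF this less.prems True assms(1)] show ?thesis .
  next
    case False
    then have "phase_phi s c x = phase_phi s c (x - 4) + 4"
      using phase_phi_add_4[OF assms(1), of "x - 4" s] by simp
    moreover have "(x - 4) div 4 + 1 = x div 4"
      using False by presburger
    ultimately show ?thesis
      using False less.IH[of "x - 4"] by (simp add: div_add_self2)
  qed
qed

section \<open>The phase bit\<close>

lemma phase_less_56: "x < 56 \<Longrightarrow> phase x"
  by (simp add: phase.simps)

lemma phase_half: "56 \<le> x \<Longrightarrow> phase x \<longleftrightarrow> \<not> phase (x div 2)"
  by (subst phase.simps) simp

text \<open>The phase changes only at the numbers \<open>56 * 2 ^ k\<close>, all multiples of 4, so
  never inside a block of four.\<close>

lemma phase_cong: "x div 4 = y div 4 \<Longrightarrow> phase x \<longleftrightarrow> phase y"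
proof (induction x arbitrary: y rule: less_induct)
  case (less x)
  show ?case
  proof (cases "x < 56")
    case True
    with less.prems have "y < 56" by presburger
    with True show ?thesis by (simp add: phase_less_56)
  next
    case False
    with less.prems have "56 \<le> y" by presburger
    moreover have "x div 2 div 4 = y div 2 div 4"
      using less.prems by (metis div_mult2_eq mult.commute)
    ultimately show ?thesis
      using False less.IH[of "x div 2" "y div 2"] by (simp add: phase_half)
  qed
qed

subsection \<open>Reduction to a finite computation\<close>

lemma locally_ok_iff:
  "locally_ok s' s a c \<longleftrightarrow>
    phase_phi s c (phase_phi s c a) = a \<and>
    (\<forall>c'<c. phase_phi s c' a \<noteq> phase_phi s c a) \<and>
    (a = 0 \<and> c = 0 \<or> phase_phi s c a div 2 \<noteq> phase_phi s' (c div 2) (a div 2)) \<and>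
    (\<forall>b. a \<le> b \<longrightarrow> b < phase_phi s c a \<longrightarrow>
      phase_phi s c b \<le> a \<or> b div 2 = phase_phi s' (c div 2) (a div 2) \<or>
      (\<exists>c'<c. b = phase_phi s c' a))"
  by (simp add: locally_ok_def Let_def image_iff Ball_def Bex_def) fastforce

text \<open>With both phases fixed, all values move by 48 and all halves by 24, which preserves each
  conjunct.\<close>

lemma locally_ok_add_48:
  assumes "locally_ok s' s a c" "74 \<le> a" "c < 11"
  shows "locally_ok s' s (a + 48) c"
proof -
  have shift: "phase_phi s d (x + 48) = phase_phi s d x + 48" if "d \<le> c" "a \<le> x" for d x
    using that assms(2,3) by (simp add: phase_phi_add_48)
  have half: "phase_phi s' (c div 2) ((a + 48) div 2) = phase_phi s' (c div 2) (a div 2) + 24"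
  proof -
    have "(a + 48) div 2 = a div 2 + 24" "c div 2 < 6" "32 \<le> a div 2"
      using assms(2,3) by simp_all
    then show ?thesis
      by (simp only: phase_phi_add_24)
  qed
  have "phase_phi s c (phase_phi s c a + 48) = a + 48"
  proof -
    \<comment> \<open>The bound 74 is 66 + 8: a row drops by at most 8, so the image of
      \<open>a\<close> is still in the periodic range.\<close>
    have "66 \<le> phase_phi s c a"
      using phase_phi_ge[of c a s] assms(2,3) by simp
    then show ?thesis using assms(1,3) by (simp add: phase_phi_add_48 locally_ok_iff)
  qed
  moreover have "phase_phi s c b \<le> a + 48 \<or> b div 2 = phase_phi s' (c div 2) (a div 2) + 24 \<or>
      (\<exists>c'<c. b = phase_phi s c' (a + 48))"
    if "a + 48 \<le> b" "b < phase_phi s c a + 48" for b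
  proof -
    define b0 where "b0 = b - 48"
    with that have b0: "b = b0 + 48" "a \<le> b0" "b0 < phase_phi s c a"
      by simp_all
    then have "phase_phi s c b0 \<le> a \<or> b0 div 2 = phase_phi s' (c div 2) (a div 2) \<or>
        (\<exists>c'<c. b0 = phase_phi s c' a)"
      using assms(1) by (simp add: locally_ok_iff)
    moreover have "b div 2 = b0 div 2 + 24"
      using b0(1) by simp
    ultimately show ?thesis
      using b0 shift[of c b0] shift[OF _ order_refl] by (auto simp: less_imp_le)
  qed
  moreover have "\<forall>c'<c. phase_phi s c' a \<noteq> phase_phi s c a"
    "(phase_phi s c a + 48) div 2 \<noteq> phase_phi s' (c div 2) (a div 2) + 24"
    using assms(1,2) unfolding locally_ok_iff by auto
  ultimately show ?thesis
    unfolding locally_ok_iff half by (simp add: shift)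
qed

lemma locally_ok_init:
  assumes "a < 56" "c < 11"
  shows "locally_ok True True a c"
proof -
  have "list_all (\<lambda>a. list_all (locally_ok True True a) [0..<11]) [0..<56]"
    by code_simp
  from list_all_uptD[OF this] assms show ?thesis by simp
qed

lemma locally_ok_True_False:
  assumes "56 \<le> a" "a < 122" "c < 11"
  shows "locally_ok True False a c"
proof -
  have "list_all (\<lambda>a. list_all (locally_ok True False a) [0..<11]) [56..<122]"
    by code_simp
  from list_all_uptD[OF this] assms show ?thesis by simp
qed

lemma locally_ok_False_True:
  assumes "66 \<le> a" "a < 122" "c < 11"
  shows "locally_ok False True a c"
proof -
  have "list_all (\<lambda>a. list_all (locally_ok False True a) [0..<11]) [66..<122]"
    by code_simp
  from list_all_uptD[OF this] assms show ?thesis by simp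
qed

text \<open>The shift by 48 works from 74 on, so checking up to 122 = 74 + 48 covers a full period.
  Only the opposition of the two phases enters.\<close>

lemma locally_ok_periodic:
  assumes "66 \<le> a" "c < 11"
  shows "locally_ok (\<not> s) s a c"
  using assms(1)
proof (induction a rule: less_induct)
  case (less a)
  show ?case
  proof (cases "a < 122")
    case True
    with less.prems assms(2) show ?thesis
      using locally_ok_False_True[of a c] locally_ok_True_False[of a c] by (cases s) auto
  next
    case False
    then show ?thesis
      using less.IH[of "a - 48"] locally_ok_add_48[of "\<not> s" s "a - 48" c] assms(2) by simp
  qed
qed

lemma locally_ok_phase:
  assumes "c < 11"
  shows "locally_ok (phase (a div 2)) (phase a) a c"
proof -
  consider "a < 56" | "56 \<le> a" "a < 66" | "66 \<le> a" by linarith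
  then show ?thesis
  proof cases
    case 1
    with assms show ?thesis by (simp add: phase_less_56 locally_ok_init)
  next
    case 2
    with assms show ?thesis by (simp add: phase_half phase_less_56 locally_ok_True_False)
  next
    case 3
    then show ?thesis using locally_ok_periodic[OF _ assms, of a "phase a"] by (simp add: phase_half)
  qed
qed

section \<open>From fixed phases to the actual involutions\<close>

lemma phi_eq_phase_phi:
  assumes "c < 4 \<Longrightarrow> phase a = phase b"
  shows "phi c b = phase_phi (phase a) c b"
  using assms phase_phi_phase_irrelevant[of c "phase a" "phase b"]
  by (cases "c < 4") (simp_all add: phi_def)

text \<open>Justifies evaluating every value in \<open>locally_ok\<close> at the phase of
  \<open>a\<close>: \<open>a\<close> and \<open>b\<close> are both below 32 or in the same block of
  four.\<close>

lemma phase_between_phi: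
  assumes "c < 4" "a \<le> b \<and> b \<le> phi c a \<or> b = phi c a"
  shows "phase a = phase b"
proof (cases "a < 32")
  case True
  with assms have "b < 32"
    using phase_phi_less_32[of c a "phase a"] by (auto simp: phi_def)
  with True show ?thesis by (simp add: phase_less_56)
next
  case False
  then have "phi c a div 4 = a div 4"
    using assms(1) by (simp add: phi_def phase_phi_div_4)
  with assms(2) have "a div 4 = b div 4"
    by (metis div_le_mono le_antisym)
  then show ?thesis by (rule phase_cong)
qed

lemma phi_phi:
  assumes "c < 11"
  shows "phi c (phi c a) = a"
proof -
  have "phi c (phi c a) = phase_phi (phase a) c (phi c a)"
    by (intro phi_eq_phase_phi phase_between_phi) auto
  also have "\<dots> = a"
    using locally_ok_phase[OF assms, of a] by (simp add: locally_ok_iff phi_def)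
  finally show ?thesis .
qed

lemma phi_neq:
  assumes "c' < c" "c < 11"
  shows "phi c' a \<noteq> phi c a"
  using locally_ok_phase[OF assms(2), of a] assms(1)
  by (auto simp: locally_ok_iff phi_def)

lemma phi_half_neq:
  assumes "c < 11" "a \<noteq> 0 \<or> c \<noteq> 0"
  shows "phi c a div 2 \<noteq> phi (c div 2) (a div 2)"
  using locally_ok_phase[OF assms(1), of a] assms(2)
  by (auto simp: locally_ok_iff phi_def)

lemma phi_cover:
  assumes "c < 11" "a \<le> b" "b < phi c a"
  shows "phi c b \<le> a \<or> b div 2 = phi (c div 2) (a div 2) \<or> (\<exists>c'<c. b = phi c' a)"
proof -
  have "phi c b = phase_phi (phase a) c b"
    using assms by (intro phi_eq_phase_phi phase_between_phi) auto
  with locally_ok_phase[OF assms(1), of a] assms(2,3) show ?thesis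
    by (auto simp: locally_ok_iff phi_def)
qed

lemma phi_0_0: "phi 0 0 = 0"
  by (simp add: phi_def phase_phi_def diff_extend_def init_row_def)

subsection \<open>The P-positions\<close>

text \<open>The right-hand side is the recursion of \<open>P_position_three_iff\<close> with
  \<open>P_position\<close> replaced by the graph of \<open>phi\<close>.\<close>

lemma eq_phi_iff:
  assumes "c < 11"
  shows "b = phi c a \<longleftrightarrow>
    (\<forall>k<a. b \<noteq> phi c k) \<and> (\<forall>k<b. k \<noteq> phi c a) \<and> (\<forall>k<c. b \<noteq> phi k a) \<and>
    (0 < a + b + c \<longrightarrow> b div 2 \<noteq> phi (c div 2) (a div 2))"
  (is "_ \<longleftrightarrow> ?no_option")
proof
  assume b: "b = phi c a"
  have "phi c a \<noteq> phi c k" if "k < a" for k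
  proof
    assume "phi c a = phi c k"
    then have "phi c (phi c a) = phi c (phi c k)"
      by (rule arg_cong)
    with that show False
      by (simp add: phi_phi[OF assms])
  qed
  moreover have "b div 2 \<noteq> phi (c div 2) (a div 2)" if "0 < a + b + c"
  proof -
    have "a \<noteq> 0 \<or> c \<noteq> 0"
      using that b phi_0_0 by (cases "a = 0 \<and> c = 0") auto
    then show ?thesis
      using b phi_half_neq[OF assms] by simp
  qed
  ultimately show ?no_option
    using b phi_neq[OF _ assms, of _ a] by force
next
  assume no_option: ?no_option
  have inv: "phi d y = x" if "y = phi d x" "d \<le> c" for d x y
    using that assms phi_phi by simp
  show "b = phi c a"
  proof (rule ccontr)
    assume "b \<noteq> phi c a"
    with no_option have less: "b < phi c a"
      using nat_neq_iff[of b "phi c a"] by blast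
    \<comment> \<open>Otherwise \<open>k = phi c b\<close> would be a smaller first pile with
      \<open>b = phi c k\<close>.\<close>
    have "\<not> phi c b < a"
      using no_option phi_phi[OF assms, of b] by auto
    moreover have "phi c b \<noteq> a"
      using \<open>b \<noteq> phi c a\<close> phi_phi[OF assms, of b] by auto
    ultimately have "a < phi c b" by simp
    have "b div 2 = phi (c div 2) (a div 2) \<or> (\<exists>c'<c. b = phi c' a)"
    \<comment> \<open>\<open>phi_cover\<close> is applied at the smaller of \<open>a\<close> and
      \<open>b\<close>; if that is \<open>b\<close>, the involutions carry the result back to
      \<open>a\<close>.\<close>
    proof (cases "a \<le> b")
      case True
      with phi_cover[OF assms _ less] \<open>a < phi c b\<close> show ?thesis by auto
    next
      case False
      then have "b \<le> a" by simp
      from phi_cover[OF assms this \<open>a < phi c b\<close>] less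
      have "a div 2 = phi (c div 2) (b div 2) \<or> (\<exists>c'<c. a = phi c' b)" by simp
      then show ?thesis
      proof
        assume "a div 2 = phi (c div 2) (b div 2)"
        then show ?thesis using inv[of "a div 2" "c div 2"] by simp
      next
        assume "\<exists>c'<c. a = phi c' b"
        then show ?thesis using inv[of a] by (auto intro: sym)
      qed
    qed
    moreover have "0 < a + b + c"
    proof (rule ccontr)
      assume "\<not> 0 < a + b + c"
      then show False
        using \<open>b \<noteq> phi c a\<close> phi_0_0 by simp
    qed
    moreover have "b \<noteq> phi k a" if "k < c" for k
      using no_option that by blast
    ultimately show False
      using no_option by auto
  qed
qed

lemma P_position_iff_phi:
  assumes "c < 11"
  shows "P_position {#a, b, c#} \<longleftrightarrow> b = phi c a"
  using assms
proof (induction "a + b + c" arbitrary: a b c rule: less_induct)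
  case less
  have "P_position {#k, b, c#} \<longleftrightarrow> b = phi c k" if "k < a" for k
    using less that by simp
  moreover have "P_position {#a, k, c#} \<longleftrightarrow> k = phi c a" if "k < b" for k
    using less that by simp
  moreover have "P_position {#a, b, k#} \<longleftrightarrow> b = phi k a" if "k < c" for k
    using less that by simp
  moreover have "P_position {#a div 2, b div 2, c div 2#} \<longleftrightarrow> b div 2 = phi (c div 2) (a div 2)"
    if "0 < a + b + c"
    using less that by (intro less.hyps) linarith+
  ultimately show ?case
    by (subst P_position_three_iff, subst eq_phi_iff[OF less.prems]) simp
qed

lemma phi_10: "phi 10 = phi10"
  by (rule ext)
    (simp add: phi_def phase_phi_def diff_extend_def init_row_def diff_row_def diff_index_def
      phi10_def length_S10 length_phi10_init)

theorem theorem42: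
  fixes a b :: nat
  shows "P_position {#a, b, 10#} \<longleftrightarrow> b = phi10 a"
  by (simp add: P_position_iff_phi phi_10)

end
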